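(* Let $M\ge 1$ and $K\ge 1$ be integers. In the three-transmitter $M\times 2M$ MIMO interference channel with $K$ users per transmitter described in the context, when the number of users $K$ is fixed and does not vary with the transmit power $P$, the achievable DoF of the opportunistic interference alignment schemes (OIA1 and OIA2) is zero: $$\lim_{P\to\infty}\frac{\mathcal{R}_{[K]}}{\log_2P}=0\qquad(K\text{ fixed}).$$
   Context: Notation: $\mathbf{X}^*$ is the conjugate transpose, $|\mathbf{X}|$ the determinant, $\lambda_n(\mathbf{X})$ the $n$th largest eigenvalue of a Hermitian matrix $\mathbf{X}$, and $\mathbf{v}_n(\mathbf{X})$ a corresponding unit eigenvector (the eigenvectors chosen orthonormal). Channel model (viewed from the first transmitter; the other transmitters are statistically identical): for each user $k\in\{1,\dots,K\}$ there are three matrices $\mathbf{H}_{k,1},\mathbf{H}_{k,2},\mathbf{H}_{k,3}\in\mathbb{C}^{2M\times M}$; $\mathbf{H}_{k,1}$ is the desired channel and $\mathbf{H}_{k,2},\mathbf{H}_{k,3}$ are the interfering channels. All entries of all these matrices are i.i.d. circularly symmetric complex Gaussian with zero mean and unit variance. Noise has identity covariance and each transmitter sends $M$ streams with equal power $P/M$. If user $k$ uses a postprocessing matrix $\mathbf{F}_k\in\mathbb{C}^{M\times 2M}$ with $\mathbf{F}_k\mathbf{F}_k^*=\mathbf{I}_M$, its achievable rate is $R_k=R_k^+-R_k^-$ with $$R_k^+=\log_2\Big|\mathbf{I}_M+\tfrac{P}{M}\sum_{i=1}^3\mathbf{F}_k\mathbf{H}_{k,i}\mathbf{H}_{k,i}^*\mathbf{F}_k^*\Big|,\qquad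 R_k^-=\log_2\Big|\mathbf{I}_M+\tfrac{P}{M}\sum_{i=2}^3\mathbf{F}_k\mathbf{H}_{k,i}\mathbf{H}_{k,i}^*\mathbf{F}_k^*\Big|.$$ OIA schemes: put $\mathbf{B}_k=\mathbf{H}_{k,2}\mathbf{H}_{k,2}^*+\mathbf{H}_{k,3}\mathbf{H}_{k,3}^*$. In both schemes the postprocessing matrix is $\mathbf{F}_k=[\mathbf{v}_{M+1}(\mathbf{B}_k),\dots,\mathbf{v}_{2M}(\mathbf{B}_k)]^*$. OIA1 selects the user $k^\star=\arg\min_k\prod_{m=M+1}^{2M}\big(1+\frac{P}{M}\lambda_m(\mathbf{B}_k)\big)$. OIA2 selects the user $k^\star=\arg\min_k d_c^2(\tilde{\mathbf{H}}_{k,2},\tilde{\mathbf{H}}_{k,3})$, where $\tilde{\mathbf{H}}_{k,i}\in\mathbb{C}^{2M\times M}$ is any matrix with orthonormal columns spanning the column space of $\mathbf{H}_{k,i}$, and $d_c^2(\mathbf{A},\mathbf{B})=M-\mathrm{tr}(\mathbf{A}^*\mathbf{B}\mathbf{B}^*\mathbf{A})$ is the squared chordal distance between the column spaces. The average achievable rate is $\mathcal{R}_{[K]}=\mathbb{E}[R_{k^\star}]$, and the DoF is $\lim_{P\to\infty}\mathcal{R}_{[K]}/\log_2P$. *)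

theory Defs
  imports
    "HOL-Probability.Probability"
    "Jordan_Normal_Form.Schur_Decomposition"
    "Jordan_Normal_Form.VS_Connect"
begin

text \<open>
  Matrices are those of Jordan_Normal_Form, and \<^const>\<open>mat_adjoint\<close> is the conjugate transpose.
  Indices written by the user (users, channels, eigenvalues) start at 1; matrix and vector entries
  are indexed from 0, as in the library.
\<close>

text \<open>
  The \<open>n\<close>th largest eigenvalue of a Hermitian matrix, counted with multiplicity, for
  \<open>1 \<le> n \<le> dim_row X\<close>. The roots of the characteristic polynomial of such a matrix are real,
  so nothing is lost by taking real parts.
\<close>

definition eigval :: "complex Matrix.mat \<Rightarrow> nat \<Rightarrow> real" where
  "eigval X n = rev (sorted_list_of_multiset (image_mset Re (proots (char_poly X)))) ! (n - 1)"

text \<open>\<open>v n X\<close> is a unit eigenvector for \<open>eigval X n\<close>, and the eigenvectors of \<open>X\<close> are orthonormal.\<close>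

definition orthonormal_eigenvectors ::
  "nat \<Rightarrow> (nat \<Rightarrow> complex Matrix.mat \<Rightarrow> complex Matrix.vec) \<Rightarrow> bool" where
  "orthonormal_eigenvectors N v \<longleftrightarrow>
    (\<forall>X \<in> carrier_mat N N. mat_adjoint X = X \<longrightarrow>
      (\<forall>n \<in> {1..N}. eigenvector X (v n X) (complex_of_real (eigval X n))) \<and>
      (\<forall>m \<in> {1..N}. \<forall>n \<in> {1..N}. v m X \<bullet>c v n X = (if m = n then 1 else 0)))"

text \<open>
  Circularly symmetric complex Gaussian with zero mean and unit variance: independent real and
  imaginary parts, each centred normal with variance 1/2.
\<close>

definition (in prob_space) std_complex_gaussian :: "('a \<Rightarrow> complex) \<Rightarrow> bool" where
  "std_complex_gaussian Z \<longleftrightarrow>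
    indep_var borel (\<lambda>\<omega>. Re (Z \<omega>)) borel (\<lambda>\<omega>. Im (Z \<omega>)) \<and>
    distributed M lborel (\<lambda>\<omega>. Re (Z \<omega>)) (normal_density 0 (1 / sqrt 2)) \<and>
    distributed M lborel (\<lambda>\<omega>. Im (Z \<omega>)) (normal_density 0 (1 / sqrt 2))"

text \<open>\<open>H \<omega> k i\<close> is the channel matrix from transmitter \<open>i\<close> to user \<open>k\<close>; transmitter 1 is the desired one.\<close>

locale interference_channel = prob_space \<Omega> for \<Omega> :: "'a measure" +
  fixes M K :: nat and H :: "'a \<Rightarrow> nat \<Rightarrow> nat \<Rightarrow> complex Matrix.mat"
  assumes dims: "\<And>\<omega> k i. \<lbrakk>\<omega> \<in> space \<Omega>; k \<in> {1..K}; i \<in> {1..3}\<rbrakk> \<Longrightarrow> H \<omega> k i \<in> carrier_mat (2 * M) M"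
    and entries_indep:
      "indep_vars (\<lambda>_. borel) (\<lambda>(k, i, r, c) \<omega>. H \<omega> k i $$ (r, c))
        ({1..K} \<times> {1..3} \<times> {..<2 * M} \<times> {..<M})"
    and entries_gaussian:
      "\<And>k i r c. \<lbrakk>k \<in> {1..K}; i \<in> {1..3}; r < 2 * M; c < M\<rbrakk> \<Longrightarrow>
        std_complex_gaussian (\<lambda>\<omega>. H \<omega> k i $$ (r, c))"

text \<open>
  In the following, \<open>G i\<close> (\<open>i = 1, 2, 3\<close>) are the channel matrices of one user, i.e. \<open>G = H \<omega> k\<close>.
  The determinants in the rate are those of Hermitian matrices, hence real.
\<close>

definition received_cov :: "complex Matrix.mat \<Rightarrow> complex Matrix.mat \<Rightarrow> complex Matrix.mat" where
  "received_cov F A = F * A * mat_adjoint A * mat_adjoint F"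

definition rate_plus ::
  "nat \<Rightarrow> real \<Rightarrow> complex Matrix.mat \<Rightarrow> (nat \<Rightarrow> complex Matrix.mat) \<Rightarrow> real" where
  "rate_plus M P F G = log 2 (Re (Determinant.det (1\<^sub>m M + complex_of_real (P / real M) \<cdot>\<^sub>m
     (received_cov F (G 1) + received_cov F (G 2) + received_cov F (G 3)))))"

definition rate_minus ::
  "nat \<Rightarrow> real \<Rightarrow> complex Matrix.mat \<Rightarrow> (nat \<Rightarrow> complex Matrix.mat) \<Rightarrow> real" where
  "rate_minus M P F G = log 2 (Re (Determinant.det (1\<^sub>m M + complex_of_real (P / real M) \<cdot>\<^sub>m
     (received_cov F (G 2) + received_cov F (G 3)))))"

definition interference_cov :: "(nat \<Rightarrow> complex Matrix.mat) \<Rightarrow> complex Matrix.mat" where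
  "interference_cov G = G 2 * mat_adjoint (G 2) + G 3 * mat_adjoint (G 3)"

definition postprocessing ::
  "nat \<Rightarrow> (nat \<Rightarrow> complex Matrix.mat \<Rightarrow> complex Matrix.vec) \<Rightarrow> complex Matrix.mat \<Rightarrow> complex Matrix.mat" where
  "postprocessing M v B = mat_adjoint (mat_of_cols (2 * M) (map (\<lambda>n. v n B) [M + 1..<2 * M + 1]))"

definition user_rate ::
  "nat \<Rightarrow> (nat \<Rightarrow> complex Matrix.mat \<Rightarrow> complex Matrix.vec) \<Rightarrow> real \<Rightarrow> (nat \<Rightarrow> complex Matrix.mat) \<Rightarrow> real" where
  "user_rate M v P G =
    (let F = postprocessing M v (interference_cov G) in rate_plus M P F G - rate_minus M P F G)"

text \<open>Average achievable rate when the random user \<open>s \<omega>\<close> is served.\<close>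

definition average_rate ::
  "'a measure \<Rightarrow> nat \<Rightarrow> ('a \<Rightarrow> nat \<Rightarrow> nat \<Rightarrow> complex Matrix.mat) \<Rightarrow>
   (nat \<Rightarrow> complex Matrix.mat \<Rightarrow> complex Matrix.vec) \<Rightarrow> ('a \<Rightarrow> nat) \<Rightarrow> real \<Rightarrow> real" where
  "average_rate \<Omega> M H v s P = (\<integral>\<omega>. user_rate M v P (H \<omega> (s \<omega>)) \<partial>\<Omega>)"

definition oia1_metric :: "nat \<Rightarrow> real \<Rightarrow> (nat \<Rightarrow> complex Matrix.mat) \<Rightarrow> real" where
  "oia1_metric M P G = (\<Prod>m = M + 1..2 * M. 1 + P / real M * eigval (interference_cov G) m)"

definition mat_trace :: "complex Matrix.mat \<Rightarrow> complex" where
  "mat_trace A = (\<Sum>i<dim_row A. A $$ (i, i))"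

text \<open>Here \<open>A\<close> and \<open>B\<close> have \<open>M\<close> orthonormal columns; the trace is then real.\<close>

definition chordal_dist_sq :: "nat \<Rightarrow> complex Matrix.mat \<Rightarrow> complex Matrix.mat \<Rightarrow> real" where
  "chordal_dist_sq M A B = real M - Re (mat_trace (mat_adjoint A * B * mat_adjoint B * A))"

definition orthonormal_basis_mat :: "nat \<Rightarrow> complex Matrix.mat \<Rightarrow> complex Matrix.mat \<Rightarrow> bool" where
  "orthonormal_basis_mat M A Q \<longleftrightarrow>
    Q \<in> carrier_mat (2 * M) M \<and> mat_adjoint Q * Q = 1\<^sub>m M \<and>
    vec_space.col_space (2 * M) Q = vec_space.col_space (2 * M) A"

end

theory Submission
  imports Defs "HOL-Real_Asymp.Real_Asymp"
begin

text \<open>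
  The selection rule plays no role: for a fixed number of users the rate of the selected user is
  dominated by the sum of the absolute rates of all users. For one user, \<open>[H\<^sub>2 H\<^sub>3]\<close> is a square
  matrix of independent atomless entries, hence almost surely nonsingular, so the interference
  covers all \<open>2M\<close> dimensions and, after any coisometric postprocessing, both \<open>R\<^sup>+\<close> and \<open>R\<^sup>-\<close> grow
  like \<open>M log\<^sub>2 P\<close>. Their difference is therefore \<open>o(log P)\<close> pointwise. Both logarithms lie between \<open>0\<close> and
  \<open>M log\<^sub>2 (1 + P T / M)\<close>, where \<open>T\<close> is the integrable total energy of the three channels, so dominated
  convergence gives the claim.
\<close>

section \<open>Log-determinants of positive semidefinite forms\<close>

definition sqnorm :: "complex Matrix.vec \<Rightarrow> real" where
  "sqnorm x = (\<Sum>i<dim_vec x. (cmod (vec_index x i))\<^sup>2)"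

text \<open>The squared Frobenius norm dominates the squared operator norm while being a plain sum
  over entries, so its expectation is finite for Gaussian matrices.\<close>

definition frobenius_sq :: "complex Matrix.mat \<Rightarrow> real" where
  "frobenius_sq A = (\<Sum>r<dim_row A. \<Sum>c<dim_col A. (cmod (A $$ (r, c)))\<^sup>2)"

lemma sqnorm_nonneg: "0 \<le> sqnorm x"
  by (simp add: sqnorm_def sum_nonneg)

lemma sqnorm_eq_0_iff:
  assumes "x \<in> carrier_vec n"
  shows "sqnorm x = 0 \<longleftrightarrow> x = 0\<^sub>v n"
  using assms by (auto simp: sqnorm_def sum_nonneg_eq_0_iff intro!: eq_vecI)

lemma frobenius_sq_nonneg: "0 \<le> frobenius_sq A"
  by (simp add: frobenius_sq_def sum_nonneg)

lemma cscalar_prod_self: "x \<bullet>c x = complex_of_real (sqnorm x)"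
  unfolding scalar_prod_def sqnorm_def
  by (simp add: atLeast0LessThan complex_norm_square del: of_real_power)

lemma mat_adjoint_index:
  assumes "i < dim_col A" "j < dim_row A"
  shows "mat_adjoint A $$ (i, j) = conjugate (A $$ (j, i))"
  using assms unfolding mat_adjoint_def by (simp add: mat_of_rows_index)

lemma mat_adjoint_dim [simp]:
  "dim_row (mat_adjoint A) = dim_col A" "dim_col (mat_adjoint A) = dim_row A"
  unfolding mat_adjoint_def by auto

lemma mat_adjoint_carrier [intro, simp]:
  "A \<in> carrier_mat n m \<Longrightarrow> mat_adjoint A \<in> carrier_mat m n"
  unfolding mat_adjoint_def by auto

text \<open>Exchanging the two finite sums moves a matrix to the other side of the inner product;
  this is what turns forms such as \<open>F * A * mat_adjoint A * mat_adjoint F\<close> into squared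
  norms.\<close>

lemma cscalar_prod_mult_mat_vec:
  fixes A :: "complex Matrix.mat"
  assumes A: "A \<in> carrier_mat n m" and x: "x \<in> carrier_vec m" and y: "y \<in> carrier_vec n"
  shows "(A *\<^sub>v x) \<bullet>c y = x \<bullet>c (mat_adjoint A *\<^sub>v y)"
proof -
  have "(A *\<^sub>v x) \<bullet>c y = (\<Sum>i<n. (\<Sum>j<m. A $$ (i, j) * vec_index x j) * cnj (vec_index y i))"
    using A x y by (simp add: scalar_prod_def atLeast0LessThan)
  also have "\<dots> = (\<Sum>j<m. \<Sum>i<n. A $$ (i, j) * vec_index x j * cnj (vec_index y i))"
    by (subst sum.swap) (simp add: sum_distrib_right)
  also have "\<dots> = (\<Sum>j<m. vec_index x j * cnj (\<Sum>i<n. cnj (A $$ (i, j)) * vec_index y i))"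
    by (simp add: sum_distrib_left mult_ac)
  also have "\<dots> = x \<bullet>c (mat_adjoint A *\<^sub>v y)"
    using A x y
    by (simp add: scalar_prod_def atLeast0LessThan mat_adjoint_index)
  finally show ?thesis .
qed

text \<open>Cauchy-Schwarz bounds each coordinate by the squared norm of one column of
  \<open>A\<close> times that of \<open>y\<close>; summing over the columns gives the Frobenius
  norm.\<close>

lemma sqnorm_adjoint_mult_le:
  assumes A: "A \<in> carrier_mat n m" and y: "y \<in> carrier_vec n"
  shows "sqnorm (mat_adjoint A *\<^sub>v y) \<le> frobenius_sq A * sqnorm y"
proof -
  have entry: "(cmod (vec_index (mat_adjoint A *\<^sub>v y) c))\<^sup>2
      \<le> (\<Sum>r<n. (cmod (A $$ (r, c)))\<^sup>2) * sqnorm y" if c: "c < m" for c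
  proof -
    have "vec_index (mat_adjoint A *\<^sub>v y) c = (\<Sum>r<n. cnj (A $$ (r, c)) * vec_index y r)"
      using A y c
      by (simp add: scalar_prod_def atLeast0LessThan mat_adjoint_index)
    then have "cmod (vec_index (mat_adjoint A *\<^sub>v y) c) \<le> (\<Sum>r<n. cmod (A $$ (r, c)) * cmod (vec_index y r))"
      using norm_sum[of "\<lambda>r. cnj (A $$ (r, c)) * vec_index y r" "{..<n}"]
      by (simp add: norm_mult)
    then have "(cmod (vec_index (mat_adjoint A *\<^sub>v y) c))\<^sup>2
        \<le> (\<Sum>r<n. cmod (A $$ (r, c)) * cmod (vec_index y r))\<^sup>2"
      by (rule power_mono) simp
    also have "\<dots> \<le> (\<Sum>r<n. (cmod (A $$ (r, c)))\<^sup>2) * (\<Sum>r<n. (cmod (vec_index y r))\<^sup>2)"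
      by (rule Cauchy_Schwarz_ineq_sum)
    finally show ?thesis using y by (simp add: sqnorm_def)
  qed
  have "sqnorm (mat_adjoint A *\<^sub>v y) = (\<Sum>c<m. (cmod (vec_index (mat_adjoint A *\<^sub>v y) c))\<^sup>2)"
    using mat_adjoint_carrier[OF A] by (auto simp: sqnorm_def)
  also have "\<dots> \<le> (\<Sum>c<m. (\<Sum>r<n. (cmod (A $$ (r, c)))\<^sup>2) * sqnorm y)"
    by (rule sum_mono) (use entry in simp)
  also have "\<dots> = frobenius_sq A * sqnorm y"
    using A by (subst sum_distrib_right[symmetric], subst sum.swap) (simp add: frobenius_sq_def)
  finally show ?thesis .
qed

section \<open>Determinants and logarithms through eigenvalues\<close>

text \<open>Every root of the characteristic polynomial is a Rayleigh quotient \<open>q x / sqnorm x\<close>.\<close>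

lemma det_one_plus_smult_psd:
  fixes A :: "complex Matrix.mat" and q :: "complex Matrix.vec \<Rightarrow> real"
  assumes A: "A \<in> carrier_mat n n"
    and form: "\<And>x. x \<in> carrier_vec n \<Longrightarrow> (A *\<^sub>v x) \<bullet>c x = complex_of_real (q x)"
    and nonneg: "\<And>x. x \<in> carrier_vec n \<Longrightarrow> 0 \<le> q x"
    and bound: "\<And>x. x \<in> carrier_vec n \<Longrightarrow> q x \<le> T * sqnorm x"
  obtains es :: "real list" where "length es = n"
    and "\<And>e. e \<in> set es \<Longrightarrow> 0 \<le> e \<and> e \<le> T"
    and "\<And>e. (\<And>x. x \<in> carrier_vec n \<Longrightarrow> x \<noteq> 0\<^sub>v n \<Longrightarrow> 0 < q x) \<Longrightarrow> e \<in> set es \<Longrightarrow> 0 < e"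
    and "\<And>\<rho>. Determinant.det (1\<^sub>m n + complex_of_real \<rho> \<cdot>\<^sub>m A) = complex_of_real (\<Prod>e\<leftarrow>es. 1 + \<rho> * e)"
proof -
  obtain as where as: "char_poly A = (\<Prod>a\<leftarrow>as. [:- a, 1:])" and len: "length as = n"
    using char_poly_factorized[OF A] by blast
  have eig: "\<exists>x. x \<in> carrier_vec n \<and> x \<noteq> 0\<^sub>v n \<and> a = complex_of_real (q x / sqnorm x)" if "a \<in> set as" for a
  proof -
    have "poly (char_poly A) a = 0"
      using that unfolding as poly_prod_list by (auto simp: prod_list_zero_iff)
    then obtain x where x: "x \<in> carrier_vec n" "x \<noteq> 0\<^sub>v n" "A *\<^sub>v x = a \<cdot>\<^sub>v x"
      using A by (auto simp: eigenvalue_root_char_poly[OF A, symmetric] eigenvalue_def eigenvector_def)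
    \<comment> \<open>The eigenvalue equation is paired with \<open>x\<close> itself; since the form
      takes real values, the root is real.\<close>
    have "a * complex_of_real (sqnorm x) = complex_of_real (q x)"
      using form[OF x(1)] x by (simp add: cscalar_prod_self)
    moreover have "sqnorm x \<noteq> 0" using sqnorm_eq_0_iff[OF x(1)] x(2) by simp
    ultimately show ?thesis using x by (auto simp: field_simps)
  qed
  define es where "es = map Re as"
  have as_es: "as = map complex_of_real es"
    unfolding es_def map_map by (rule sym, rule map_idI) (use eig in fastforce)
  have witness: "\<exists>x. x \<in> carrier_vec n \<and> x \<noteq> 0\<^sub>v n \<and> 0 < sqnorm x \<and> e = q x / sqnorm x" if e: "e \<in> set es" for e
  proof -
    obtain a where a: "a \<in> set as" "e = Re a" using e by (auto simp: es_def)
    obtain x where x: "x \<in> carrier_vec n" "x \<noteq> 0\<^sub>v n" "a = complex_of_real (q x / sqnorm x)"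
      using eig[OF a(1)] by blast
    show ?thesis using x a sqnorm_eq_0_iff[OF x(1)] sqnorm_nonneg[of x]
      by (intro exI[of _ x]) auto
  qed
  show ?thesis
  proof
    show "length es = n" using len by (simp add: es_def)
    show "0 \<le> e \<and> e \<le> T" if "e \<in> set es" for e
      using witness[OF that] nonneg bound by (auto simp: field_simps)
    show "0 < e" if "\<And>x. x \<in> carrier_vec n \<Longrightarrow> x \<noteq> 0\<^sub>v n \<Longrightarrow> 0 < q x" and "e \<in> set es" for e
      using witness[OF that(2)] that(1) by (auto intro: divide_pos_pos)
    show "Determinant.det (1\<^sub>m n + complex_of_real \<rho> \<cdot>\<^sub>m A) = complex_of_real (\<Prod>e\<leftarrow>es. 1 + \<rho> * e)" for \<rho>
    \<comment> \<open>For nonzero \<open>\<rho>\<close> the determinant is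
      \<open>(- \<rho>) ^ n\<close> times the characteristic polynomial at
      \<open>- 1 / \<rho>\<close>, so the value 0 is treated apart.\<close>
    proof (cases "\<rho> = 0")
      case True
      have "1\<^sub>m n + complex_of_real \<rho> \<cdot>\<^sub>m A = 1\<^sub>m n" using A True by (intro eq_matI) auto
      moreover have "(\<Prod>e\<leftarrow>es. 1 + \<rho> * e) = 1" using True by (induction es) auto
      ultimately show ?thesis using True by simp
    next
      case False
      let ?c = "complex_of_real \<rho>"
      have "1\<^sub>m n + ?c \<cdot>\<^sub>m A = (- ?c) \<cdot>\<^sub>m (- char_matrix A (- (1 / ?c)))"
        using A False by (intro eq_matI) (auto simp: char_matrix_def field_simps)
      then have "Determinant.det (1\<^sub>m n + ?c \<cdot>\<^sub>m A) = (- ?c) ^ n * poly (char_poly A) (- (1 / ?c))"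
        using A by (simp add: char_poly_matrix[OF A] char_matrix_def)
      also have "poly (char_poly A) (- (1 / ?c)) = (\<Prod>a\<leftarrow>as. - (1 / ?c) - a)"
        unfolding as poly_prod_list map_map by (intro arg_cong[where f = prod_list] map_cong) auto
      \<comment> \<open>There are exactly \<open>n\<close> linear factors, and each absorbs one
        factor \<open>- ?c\<close>.\<close>
      also have "(- ?c) ^ n * \<dots> = (\<Prod>a\<leftarrow>as. 1 + ?c * a)"
        unfolding len[symmetric]
      proof (induction as)
        case (Cons a as)
        have "- ?c * (- (1 / ?c) - a) = 1 + ?c * a" using False by (simp add: field_simps)
        moreover have "(- ?c) ^ length (a # as) * (\<Prod>a\<leftarrow>a # as. - (1 / ?c) - a) =
            (- ?c * (- (1 / ?c) - a)) * ((- ?c) ^ length as * (\<Prod>a\<leftarrow>as. - (1 / ?c) - a))"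
          by (simp only: list.map prod_list.Cons length_Cons power_Suc mult_ac)
        ultimately show ?case using Cons by simp
      qed simp
      also have "\<dots> = complex_of_real (\<Prod>e\<leftarrow>es. 1 + \<rho> * e)"
        unfolding as_es by (induction es) auto
      finally show ?thesis .
    qed
  qed
qed

text \<open>Splitting the logarithm of a product requires positive factors, so the lower bound 1 on
  the product is carried through the same induction.\<close>

lemma log_prod_list:
  assumes "\<And>e. e \<in> set es \<Longrightarrow> 0 \<le> e" "0 \<le> (\<rho>::real)"
  shows "log 2 (\<Prod>e\<leftarrow>es. 1 + \<rho> * e) = (\<Sum>e\<leftarrow>es. log 2 (1 + \<rho> * e)) \<and> 1 \<le> (\<Prod>e\<leftarrow>es. 1 + \<rho> * e)"
  using assms(1)
proof (induction es)
  case (Cons e es)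
  have "1 \<le> 1 + \<rho> * e" using Cons.prems assms(2) by simp
  moreover from Cons have "log 2 (\<Prod>e\<leftarrow>es. 1 + \<rho> * e) = (\<Sum>e\<leftarrow>es. log 2 (1 + \<rho> * e))"
    and "1 \<le> (\<Prod>e\<leftarrow>es. 1 + \<rho> * e)" by auto
  ultimately show ?case by (auto simp: log_mult_pos intro!: mult_ge1_I)
qed simp

text \<open>\<open>L P\<close> is the sum of \<open>log 2 (1 + P / m * e)\<close> over the
  eigenvalues \<open>e\<close> of \<open>A\<close>. Each term lies between 0 and its value at
  \<open>e = T\<close>. If the form is definite, all \<open>e\<close> are positive, each of the
  \<open>n\<close> terms grows like \<open>log 2 P\<close>, and the quotient tends to
  \<open>n\<close>.\<close>

lemma log_det_one_plus_psd:
  fixes A :: "complex Matrix.mat" and q :: "complex Matrix.vec \<Rightarrow> real" and m :: real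
  assumes A: "A \<in> carrier_mat n n"
    and form: "\<And>x. x \<in> carrier_vec n \<Longrightarrow> (A *\<^sub>v x) \<bullet>c x = complex_of_real (q x)"
    and nonneg: "\<And>x. x \<in> carrier_vec n \<Longrightarrow> 0 \<le> q x"
    and bound: "\<And>x. x \<in> carrier_vec n \<Longrightarrow> q x \<le> T * sqnorm x"
    and m: "m > 0"
  defines "L \<equiv> \<lambda>P. log 2 (Re (Determinant.det (1\<^sub>m n + complex_of_real (P / m) \<cdot>\<^sub>m A)))"
  shows "P > 0 \<Longrightarrow> 0 \<le> T \<Longrightarrow> 0 \<le> L P \<and> L P \<le> n * log 2 (1 + P / m * T)"
    and "(\<And>x. x \<in> carrier_vec n \<Longrightarrow> x \<noteq> 0\<^sub>v n \<Longrightarrow> 0 < q x) \<Longrightarrow>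
      ((\<lambda>P. L P / log 2 P) \<longlongrightarrow> real n) at_top"
proof -
  obtain es where es: "length es = n" "\<And>e. e \<in> set es \<Longrightarrow> 0 \<le> e \<and> e \<le> T"
    "\<And>e. (\<And>x. x \<in> carrier_vec n \<Longrightarrow> x \<noteq> 0\<^sub>v n \<Longrightarrow> 0 < q x) \<Longrightarrow> e \<in> set es \<Longrightarrow> 0 < e"
    "\<And>\<rho>. Determinant.det (1\<^sub>m n + complex_of_real \<rho> \<cdot>\<^sub>m A) = complex_of_real (\<Prod>e\<leftarrow>es. 1 + \<rho> * e)"
    using det_one_plus_smult_psd[OF A form nonneg bound] by blast
  have L: "L P = (\<Sum>e\<leftarrow>es. log 2 (1 + P / m * e))" if "P > 0" for P
    unfolding L_def es(4) using log_prod_list[of es "P / m"] es(2) that m by simp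
  show "0 \<le> L P \<and> L P \<le> n * log 2 (1 + P / m * T)" if P: "P > 0" and T: "0 \<le> T"
  proof
    show "0 \<le> L P"
      unfolding L[OF P] using es(2) P m
      by (intro sum_list_nonneg) (auto intro!: zero_le_log_cancel_iff[THEN iffD2] add_pos_nonneg)
    have "log 2 (1 + P / m * e) \<le> log 2 (1 + P / m * T)" if "e \<in> set es" for e
    proof -
      have "P / m * e \<le> P / m * T" "0 \<le> P / m * e"
        using es(2)[OF that] P m by (auto intro!: mult_left_mono divide_right_mono)
      then show ?thesis by (simp del: times_divide_eq_left)
    qed
    then have "L P \<le> (\<Sum>e\<leftarrow>es. log 2 (1 + P / m * T))"
      unfolding L[OF P] by (intro sum_list_mono)
    then show "L P \<le> n * log 2 (1 + P / m * T)"
      by (simp add: sum_list_triv es(1))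
  qed
  show "((\<lambda>P. L P / log 2 P) \<longlongrightarrow> real n) at_top"
    if pos: "\<And>x. x \<in> carrier_vec n \<Longrightarrow> x \<noteq> 0\<^sub>v n \<Longrightarrow> 0 < q x"
  proof -
    have "\<And>e. e \<in> set es \<Longrightarrow> 0 < e" using es(3) pos by blast
    \<comment> \<open>The limit is expressed as the length of the list, so the induction over
      \<open>es\<close> need not carry the constraint that the length is \<open>n\<close>.\<close>
    then have "((\<lambda>P. (\<Sum>e\<leftarrow>es. log 2 (1 + P / m * e)) / log 2 P) \<longlongrightarrow> real (length es)) at_top"
    proof (induction es)
      case (Cons e es)
      have "((\<lambda>P. log 2 (1 + P / m * e) / log 2 P) \<longlongrightarrow> 1) at_top"
        using Cons.prems[of e] m by simp real_asymp
      from tendsto_add[OF this Cons.IH] Cons.prems show ?case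
        by (simp add: add_divide_distrib)
    qed simp
    moreover have "\<forall>\<^sub>F P in at_top. (\<Sum>e\<leftarrow>es. log 2 (1 + P / m * e)) / log 2 P = L P / log 2 P"
      using eventually_gt_at_top[of 0] by eventually_elim (simp add: L)
    ultimately show ?thesis unfolding es(1) by (rule Lim_transform_eventually)
  qed
qed

section \<open>Random matrices\<close>

text \<open>Entries are meaningful only within the dimensions, so these are fixed on the whole
  sample space; matrix operations then reduce to their index formulas.\<close>

definition measurable_mat :: "'a measure \<Rightarrow> nat \<Rightarrow> nat \<Rightarrow> ('a \<Rightarrow> complex Matrix.mat) \<Rightarrow> bool" where
  "measurable_mat N n m A \<longleftrightarrow> (\<forall>\<omega>\<in>space N. A \<omega> \<in> carrier_mat n m) \<and>
     (\<forall>i<n. \<forall>j<m. (\<lambda>\<omega>. A \<omega> $$ (i, j)) \<in> borel_measurable N)"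

lemma measurable_matI:
  assumes "\<And>\<omega>. \<omega> \<in> space N \<Longrightarrow> A \<omega> \<in> carrier_mat n m"
    and "\<And>i j. i < n \<Longrightarrow> j < m \<Longrightarrow> B i j \<in> borel_measurable N"
    and "\<And>i j \<omega>. i < n \<Longrightarrow> j < m \<Longrightarrow> \<omega> \<in> space N \<Longrightarrow> A \<omega> $$ (i, j) = B i j \<omega>"
  shows "measurable_mat N n m A"
  unfolding measurable_mat_def
proof (intro conjI ballI allI impI assms(1))
  fix i j assume "i < n" "j < m"
  then show "(\<lambda>\<omega>. A \<omega> $$ (i, j)) \<in> borel_measurable N"
    using assms(2)[of i j] assms(3)[of i j] by (subst measurable_cong) auto
qed

lemma measurable_matD:
  assumes "measurable_mat N n m A"
  shows "\<omega> \<in> space N \<Longrightarrow> A \<omega> \<in> carrier_mat n m"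
    and "\<omega> \<in> space N \<Longrightarrow> dim_row (A \<omega>) = n" and "\<omega> \<in> space N \<Longrightarrow> dim_col (A \<omega>) = m"
    and "i < n \<Longrightarrow> j < m \<Longrightarrow> (\<lambda>\<omega>. A \<omega> $$ (i, j)) \<in> borel_measurable N"
  using assms unfolding measurable_mat_def by (blast dest: carrier_matD)+

lemma measurable_mat_one: "measurable_mat N n n (\<lambda>_. 1\<^sub>m n)"
  by (rule measurable_matI[where B = "\<lambda>i j _. 1\<^sub>m n $$ (i, j)"]) auto

lemma measurable_mat_mult:
  assumes A: "measurable_mat N n m A" and B: "measurable_mat N m p B"
  shows "measurable_mat N n p (\<lambda>\<omega>. A \<omega> * B \<omega>)"
proof (rule measurable_matI[where B = "\<lambda>i j \<omega>. \<Sum>k<m. A \<omega> $$ (i, k) * B \<omega> $$ (k, j)"])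
  fix i j assume ij: "i < n" "j < p"
  show "(\<lambda>\<omega>. \<Sum>k<m. A \<omega> $$ (i, k) * B \<omega> $$ (k, j)) \<in> borel_measurable N"
    using measurable_matD(4)[OF A ij(1)] measurable_matD(4)[OF B _ ij(2)]
    by (intro borel_measurable_sum borel_measurable_times) auto
qed (use measurable_matD(1-3)[OF A] measurable_matD(1-3)[OF B] in
    \<open>auto simp: scalar_prod_def atLeast0LessThan\<close>)

lemma measurable_mat_add:
  assumes A: "measurable_mat N n m A" and B: "measurable_mat N n m B"
  shows "measurable_mat N n m (\<lambda>\<omega>. A \<omega> + B \<omega>)"
  by (rule measurable_matI[where B = "\<lambda>i j \<omega>. A \<omega> $$ (i, j) + B \<omega> $$ (i, j)"])
    (use measurable_matD[OF A] measurable_matD[OF B] in auto)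

lemma measurable_mat_smult:
  assumes A: "measurable_mat N n m A"
  shows "measurable_mat N n m (\<lambda>\<omega>. c \<cdot>\<^sub>m A \<omega>)"
  by (rule measurable_matI[where B = "\<lambda>i j \<omega>. c * A \<omega> $$ (i, j)"])
    (use measurable_matD[OF A] in auto)

lemma borel_measurable_cnj:
  "f \<in> borel_measurable N \<Longrightarrow> (\<lambda>x. cnj (f x)) \<in> borel_measurable N"
  by (rule measurable_compose[where g = cnj])
    (auto intro: borel_measurable_continuous_onI continuous_on_cnj continuous_on_id)

lemma measurable_mat_adjoint:
  assumes A: "measurable_mat N n m A"
  shows "measurable_mat N m n (\<lambda>\<omega>. mat_adjoint (A \<omega>))"
proof (rule measurable_matI[where B = "\<lambda>i j \<omega>. cnj (A \<omega> $$ (j, i))"])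
  show "(\<lambda>\<omega>. cnj (A \<omega> $$ (j, i))) \<in> borel_measurable N" if "i < m" "j < n" for i j
    using measurable_matD(4)[OF A that(2,1)] by (rule borel_measurable_cnj)
qed (use measurable_matD(1-3)[OF A] in \<open>auto simp: mat_adjoint_index\<close>)

text \<open>By the Leibniz formula the determinant is a polynomial in the entries.\<close>

lemma borel_measurable_det:
  assumes A: "measurable_mat N n n A"
  shows "(\<lambda>\<omega>. Determinant.det (A \<omega>)) \<in> borel_measurable N"
proof (subst measurable_cong)
  show "Determinant.det (A \<omega>) = (\<Sum>p\<in>{p. p permutes {0..<n}}. signof p * (\<Prod>i = 0..<n. A \<omega> $$ (i, p i)))"
    if "\<omega> \<in> space N" for \<omega>
    using det_def'[OF measurable_matD(1)[OF A that]] .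
  show "(\<lambda>\<omega>. \<Sum>p\<in>{p. p permutes {0..<n}}. signof p * (\<Prod>i = 0..<n. A \<omega> $$ (i, p i))) \<in> borel_measurable N"
    using measurable_matD(4)[OF A]
    by (intro borel_measurable_sum borel_measurable_times borel_measurable_prod)
      (auto simp: permutes_in_image)
qed

section \<open>Almost sure nonsingularity\<close>

text \<open>Setting the corner entry to 0 leaves all cofactors of the last row unchanged, so the
  Laplace expansions of the two matrices along that row differ exactly by the corner term.\<close>

lemma det_corner_expansion:
  fixes A :: "'a :: comm_ring_1 Matrix.mat"
  assumes A: "A \<in> carrier_mat (Suc n) (Suc n)"
  shows "Determinant.det A = A $$ (n, n) * Determinant.det (Matrix.mat n n (\<lambda>p. A $$ p)) +
    Determinant.det (Matrix.mat (Suc n) (Suc n) (\<lambda>p. if p = (n, n) then 0 else A $$ p))"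
proof -
  let ?B = "Matrix.mat (Suc n) (Suc n) (\<lambda>p. if p = (n, n) then 0 else A $$ p)"
  have B: "?B \<in> carrier_mat (Suc n) (Suc n)" by simp
  have cof: "cofactor ?B n j = cofactor A n j" if "j < Suc n" for j
    unfolding cofactor_def
    by (rule arg_cong[where f = "\<lambda>X. (- 1) ^ (n + j) * Determinant.det X"])
      (use A that in \<open>auto simp: mat_delete_def intro!: eq_matI\<close>)
  have minor: "cofactor A n n = Determinant.det (Matrix.mat n n (\<lambda>p. A $$ p))"
    unfolding cofactor_def using A
    by (auto simp: mat_delete_def mult_2[symmetric] intro!: arg_cong[where f = Determinant.det] eq_matI)
  have "Determinant.det ?B = (\<Sum>j<Suc n. ?B $$ (n, j) * cofactor ?B n j)"
    by (rule laplace_expansion_row[OF B]) simp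
  also have "\<dots> = (\<Sum>j<n. A $$ (n, j) * cofactor A n j)"
    by (simp add: cof)
  finally have "Determinant.det ?B = (\<Sum>j<n. A $$ (n, j) * cofactor A n j)" .
  moreover have "Determinant.det A = (\<Sum>j<Suc n. A $$ (n, j) * cofactor A n j)"
    by (rule laplace_expansion_row[OF A]) simp
  ultimately show ?thesis by (simp add: minor)
qed

text \<open>By independence the joint law is a product, so Fubini allows \<open>Y\<close> to be
  frozen. For a fixed nonzero slope the affine function has a single zero \<open>- c / b\<close>,
  and \<open>f (X \<omega>)\<close> avoids any single value almost surely.\<close>

lemma (in prob_space) AE_affine_nonzero:
  fixes f b c :: "'b \<Rightarrow> complex"
  assumes indep: "indep_var S Y T X"
    and [measurable]: "b \<in> borel_measurable S" "c \<in> borel_measurable S" "f \<in> borel_measurable T"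
    and slope: "AE \<omega> in M. b (Y \<omega>) \<noteq> 0"
    and atomless: "\<And>z. AE \<omega> in M. f (X \<omega>) \<noteq> z"
  shows "AE \<omega> in M. f (X \<omega>) * b (Y \<omega>) + c (Y \<omega>) \<noteq> 0"
proof -
  \<comment> \<open>The slope is nonzero only almost surely, so this condition is made a premise of
    the predicate and discharged after returning to \<open>M\<close>.\<close>
  let ?Q = "\<lambda>p. b (fst p) \<noteq> 0 \<longrightarrow> f (snd p) * b (fst p) + c (fst p) \<noteq> 0"
  have X[measurable]: "X \<in> M \<rightarrow>\<^sub>M T" and Y[measurable]: "Y \<in> M \<rightarrow>\<^sub>M S"
    and joint: "distr M S Y \<Otimes>\<^sub>M distr M T X = distr M (S \<Otimes>\<^sub>M T) (\<lambda>\<omega>. (Y \<omega>, X \<omega>))"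
    using indep unfolding indep_var_distribution_eq by auto
  interpret DX: prob_space "distr M T X" by (rule prob_space_distr) simp
  interpret DY: prob_space "distr M S Y" by (rule prob_space_distr) simp
  interpret P: pair_sigma_finite "distr M S Y" "distr M T X" ..
  have "AE p in distr M S Y \<Otimes>\<^sub>M distr M T X. ?Q p"
  proof (rule P.AE_pair_measure)
    show "{p \<in> space (distr M S Y \<Otimes>\<^sub>M distr M T X). ?Q p} \<in> sets (distr M S Y \<Otimes>\<^sub>M distr M T X)"
      by measurable
    show "AE y in distr M S Y. AE x in distr M T X. ?Q (y, x)"
    proof (rule AE_I2)
      fix y assume "y \<in> space (distr M S Y)"
      have "f x = - c y / b y" if "b y \<noteq> 0" "f x * b y + c y = 0" for x
        using that by (simp add: field_simps add_eq_0_iff2)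
      then show "AE x in distr M T X. ?Q (y, x)"
        using atomless[of "- c y / b y"]
        by (subst AE_distr_iff) (auto elim!: eventually_mono)
    qed
  qed
  then have "AE \<omega> in M. ?Q (Y \<omega>, X \<omega>)"
    unfolding joint by (subst (asm) AE_distr_iff) auto
  with slope show ?thesis by eventually_elim simp
qed

text \<open>
  The determinant is affine in the corner entry; its slope is the leading minor, and slope and
  offset are independent of the corner entry.
\<close>

lemma (in prob_space) AE_det_nonzero:
  fixes X :: "'i \<Rightarrow> 'a \<Rightarrow> complex"
  assumes indep: "indep_vars (\<lambda>_. borel) X J"
    and atomless: "\<And>a z. a \<in> J \<Longrightarrow> AE \<omega> in M. X a \<omega> \<noteq> z"
    and inj: "inj_on \<phi> ({..<n} \<times> {..<n})"
    and range: "\<phi> ` ({..<n} \<times> {..<n}) \<subseteq> J"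
  shows "AE \<omega> in M. Determinant.det (Matrix.mat n n (\<lambda>p. X (\<phi> p) \<omega>)) \<noteq> 0"
  using inj range
proof (induction n)
  case 0
  have "Determinant.det (Matrix.mat 0 0 f) = 1" for f :: "nat \<times> nat \<Rightarrow> complex"
    by (rule det_dim_zero) simp
  then show ?case by simp
next
  case (Suc n)
  define a where "a = \<phi> (n, n)"
  define B where "B = \<phi> ` ({..<Suc n} \<times> {..<Suc n} - {(n, n)})"
  \<comment> \<open>Slope \<open>b\<close> and offset \<open>c\<close> are functions of a whole
    family \<open>f\<close> of entries, which makes them measurable maps on the product space over
    the indices \<open>B\<close> other than the corner \<open>a\<close>.\<close>
  define b where "b f = Determinant.det (Matrix.mat n n (\<lambda>p. f (\<phi> p)))" for f :: "'i \<Rightarrow> complex"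
  define c where "c f = Determinant.det (Matrix.mat (Suc n) (Suc n) (\<lambda>p. if p = (n, n) then 0 else f (\<phi> p)))"
    for f :: "'i \<Rightarrow> complex"
  have aJ: "a \<in> J" and BJ: "B \<subseteq> J" and aB: "a \<notin> B"
    using Suc.prems by (auto simp: a_def B_def dest: inj_onD)
  have in_B: "\<phi> (i, j) \<in> B" if "i < Suc n" "j < Suc n" "(i, j) \<noteq> (n, n)" for i j
    using that by (auto simp: B_def)
  have entry: "(\<lambda>f. f (\<phi> (i, j))) \<in> borel_measurable (Pi\<^sub>M B (\<lambda>_. borel))"
    if "i < Suc n" "j < Suc n" "(i, j) \<noteq> (n, n)" for i j
    using in_B[OF that] by measurable
  have b: "b \<in> borel_measurable (Pi\<^sub>M B (\<lambda>_. borel))"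
    unfolding b_def
    by (intro borel_measurable_det measurable_matI[where B = "\<lambda>i j f. f (\<phi> (i, j))"]) (auto intro: entry)
  have c: "c \<in> borel_measurable (Pi\<^sub>M B (\<lambda>_. borel))"
    unfolding c_def
    by (intro borel_measurable_det
        measurable_matI[where B = "\<lambda>i j. if (i, j) = (n, n) then (\<lambda>_. 0) else (\<lambda>f. f (\<phi> (i, j)))"])
      (auto intro: entry)
  \<comment> \<open>Neither \<open>b\<close> nor \<open>c\<close> reads the corner entry, so
    restricting the family to \<open>B\<close> changes nothing.\<close>
  have b_eq: "b (restrict (\<lambda>i. X i \<omega>) B) = b (\<lambda>i. X i \<omega>)"
    and c_eq: "c (restrict (\<lambda>i. X i \<omega>) B) = c (\<lambda>i. X i \<omega>)" for \<omega>
    unfolding b_def c_def by (intro arg_cong[where f = Determinant.det] eq_matI; auto simp: in_B)+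
  have IH: "AE \<omega> in M. b (\<lambda>i. X i \<omega>) \<noteq> 0"
    unfolding b_def by (rule Suc.IH) (use Suc.prems in \<open>auto elim: inj_on_subset\<close>)
  have "indep_var (Pi\<^sub>M B (\<lambda>_. borel)) (\<lambda>\<omega>. restrict (\<lambda>i. X i \<omega>) B)
      (Pi\<^sub>M {a} (\<lambda>_. borel)) (\<lambda>\<omega>. restrict (\<lambda>i. X i \<omega>) {a})"
    by (rule indep_var_restrict[OF indep]) (use aJ BJ aB in auto)
  from AE_affine_nonzero[OF this b c, of "\<lambda>f. f a"]
  have "AE \<omega> in M. X a \<omega> * b (\<lambda>i. X i \<omega>) + c (\<lambda>i. X i \<omega>) \<noteq> 0"
    using IH atomless[OF aJ] by (simp add: b_eq c_eq)
  moreover have "Determinant.det (Matrix.mat (Suc n) (Suc n) (\<lambda>p. X (\<phi> p) \<omega>)) =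
      X a \<omega> * b (\<lambda>i. X i \<omega>) + c (\<lambda>i. X i \<omega>)" for \<omega>
    unfolding b_def c_def
    by (subst det_corner_expansion[of _ n])
      (auto simp: a_def intro!: arg_cong2[where f = plus] arg_cong2[where f = times]
        arg_cong[where f = Determinant.det] eq_matI)
  ultimately show ?case by simp
qed

section \<open>Properties of the complex Gaussian law\<close>

lemma (in prob_space) std_complex_gaussian_measurable:
  assumes "std_complex_gaussian Z"
  shows "Z \<in> borel_measurable M"
proof -
  have "(\<lambda>\<omega>. Re (Z \<omega>)) \<in> borel_measurable M" "(\<lambda>\<omega>. Im (Z \<omega>)) \<in> borel_measurable M"
    using assms unfolding std_complex_gaussian_def by (auto dest: distributed_measurable)
  then show ?thesis by (simp add: borel_measurable_complex_iff)
qed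

text \<open>Already the real part avoids any given value almost surely, because it has a Lebesgue
  density.\<close>

lemma (in prob_space) std_complex_gaussian_atomless:
  assumes "std_complex_gaussian Z"
  shows "AE \<omega> in M. Z \<omega> \<noteq> z"
proof -
  have D: "distributed M lborel (\<lambda>\<omega>. Re (Z \<omega>)) (normal_density 0 (1 / sqrt 2))"
    using assms unfolding std_complex_gaussian_def by blast
  have [measurable]: "(\<lambda>\<omega>. Re (Z \<omega>)) \<in> borel_measurable M"
    using distributed_measurable[OF D] by simp
  have "AE x in lborel. x \<noteq> Re z" by (rule AE_lborel_singleton)
  then have "AE x in density lborel (normal_density 0 (1 / sqrt 2)). x \<noteq> Re z"
    by (subst AE_density) auto
  then have "AE x in distr M lborel (\<lambda>\<omega>. Re (Z \<omega>)). x \<noteq> Re z"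
    unfolding distributed_distr_eq_density[OF D] .
  then have "AE \<omega> in M. Re (Z \<omega>) \<noteq> Re z"
    by (subst (asm) AE_distr_iff) auto
  then show ?thesis by eventually_elim auto
qed

text \<open>The squared modulus splits into the squares of real and imaginary part, and normal laws
  have finite second moments.\<close>

lemma (in prob_space) std_complex_gaussian_square_integrable:
  assumes "std_complex_gaussian Z"
  shows "integrable M (\<lambda>\<omega>. (cmod (Z \<omega>))\<^sup>2)"
proof -
  have *: "integrable M (\<lambda>\<omega>. (X \<omega>)\<^sup>2)"
    if "distributed M lborel X (normal_density 0 (1 / sqrt 2))" for X :: "'a \<Rightarrow> real"
    using distributed_integrable[OF that, of "\<lambda>x. x\<^sup>2"]
      integrable_normal_moment[of "1 / sqrt 2" 0 2] by simp
  show ?thesis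
    using assms unfolding std_complex_gaussian_def cmod_power2
    by (intro Bochner_Integration.integrable_add *) auto
qed

section \<open>Rates\<close>

text \<open>Moving \<open>F\<close> and then \<open>A\<close> across the inner product exhibits the
  form as a squared norm; this provides the real nonnegative \<open>q\<close> required by the
  log-determinant estimates.\<close>

lemma received_cov_form:
  assumes F: "F \<in> carrier_mat m n" and A: "A \<in> carrier_mat n p" and x: "x \<in> carrier_vec m"
  shows "(received_cov F A *\<^sub>v x) \<bullet>c x =
    complex_of_real (sqnorm (mat_adjoint A *\<^sub>v (mat_adjoint F *\<^sub>v x)))"
proof -
  note F' = mat_adjoint_carrier[OF F] and A' = mat_adjoint_carrier[OF A]
  define y where "y = mat_adjoint F *\<^sub>v x"
  have y: "y \<in> carrier_vec n" using F' x by (simp add: y_def)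
  have "received_cov F A *\<^sub>v x = (F * A * mat_adjoint A) *\<^sub>v y"
    unfolding received_cov_def y_def
    by (rule assoc_mult_mat_vec[OF mult_carrier_mat[OF mult_carrier_mat[OF F A] A'] F' x])
  also have "\<dots> = (F * A) *\<^sub>v (mat_adjoint A *\<^sub>v y)"
    by (rule assoc_mult_mat_vec[OF mult_carrier_mat[OF F A] A' y])
  also have "\<dots> = F *\<^sub>v (A *\<^sub>v (mat_adjoint A *\<^sub>v y))"
    by (rule assoc_mult_mat_vec[OF F A mult_mat_vec_carrier[OF A' y]])
  finally have "(received_cov F A *\<^sub>v x) \<bullet>c x = (A *\<^sub>v (mat_adjoint A *\<^sub>v y)) \<bullet>c y"
    using cscalar_prod_mult_mat_vec[OF F mult_mat_vec_carrier[OF A mult_mat_vec_carrier[OF A' y]] x]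
    by (simp add: y_def)
  also have "\<dots> = complex_of_real (sqnorm (mat_adjoint A *\<^sub>v y))"
    using cscalar_prod_mult_mat_vec[OF A mult_mat_vec_carrier[OF A' y] y] by (simp add: cscalar_prod_self)
  finally show ?thesis by (simp add: y_def)
qed

lemma received_cov_carrier:
  "F \<in> carrier_mat m n \<Longrightarrow> A \<in> carrier_mat n p \<Longrightarrow> received_cov F A \<in> carrier_mat m m"
  unfolding received_cov_def by (intro mult_carrier_mat mat_adjoint_carrier)

text \<open>The squared norm of \<open>mat_adjoint F *\<^sub>v x\<close> is the inner product of
  \<open>F *\<^sub>v (mat_adjoint F *\<^sub>v x) = x\<close> with \<open>x\<close>. Hence
  postprocessing preserves both energy bounds and definiteness.\<close>

lemma sqnorm_coisometry_adjoint:
  assumes F: "F \<in> carrier_mat m n" and isom: "F * mat_adjoint F = 1\<^sub>m m" and x: "x \<in> carrier_vec m"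
  shows "sqnorm (mat_adjoint F *\<^sub>v x) = sqnorm x"
proof -
  note F' = mat_adjoint_carrier[OF F]
  have "F *\<^sub>v (mat_adjoint F *\<^sub>v x) = x"
    using assoc_mult_mat_vec[OF F F' x] isom x by simp
  then have "complex_of_real (sqnorm x) = (F *\<^sub>v (mat_adjoint F *\<^sub>v x)) \<bullet>c x"
    by (simp add: cscalar_prod_self)
  also have "\<dots> = complex_of_real (sqnorm (mat_adjoint F *\<^sub>v x))"
    using F' x by (simp add: cscalar_prod_mult_mat_vec[OF F] cscalar_prod_self)
  finally show ?thesis by simp
qed

text \<open>One bound \<open>T\<close> for the forms behind both rates: the interference form is the
  full form without its nonnegative desired part.\<close>

definition channel_energy :: "(nat \<Rightarrow> complex Matrix.mat) \<Rightarrow> real" where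
  "channel_energy G = frobenius_sq (G 1) + frobenius_sq (G 2) + frobenius_sq (G 3)"

lemma channel_energy_nonneg: "0 \<le> channel_energy G"
  by (simp add: channel_energy_def frobenius_sq_nonneg)

text \<open>Both logarithms lie in the same interval starting at 0, so their difference is at most
  its length. If the interference form is definite on the whole space, so are both forms after
  postprocessing; both logarithms then grow like \<open>M * log 2 P\<close> and the leading terms
  cancel.\<close>

lemma rate_bounds:
  assumes M: "M \<ge> 1" and G: "\<And>i. i \<in> {1..3} \<Longrightarrow> G i \<in> carrier_mat (2 * M) M"
    and F: "F \<in> carrier_mat M (2 * M)" and isom: "F * mat_adjoint F = 1\<^sub>m M"
  shows "P > 0 \<Longrightarrow> \<bar>rate_plus M P F G - rate_minus M P F G\<bar> \<le> M * log 2 (1 + P / M * channel_energy G)"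
    and "(\<And>y. y \<in> carrier_vec (2 * M) \<Longrightarrow> y \<noteq> 0\<^sub>v (2 * M) \<Longrightarrow>
        0 < sqnorm (mat_adjoint (G 2) *\<^sub>v y) + sqnorm (mat_adjoint (G 3) *\<^sub>v y)) \<Longrightarrow>
      ((\<lambda>P. (rate_plus M P F G - rate_minus M P F G) / log 2 P) \<longlongrightarrow> 0) at_top"
proof -
  define s where "s i x = sqnorm (mat_adjoint (G i) *\<^sub>v (mat_adjoint F *\<^sub>v x))" for i x
  let ?R = "\<lambda>i. received_cov F (G i)"
  let ?qp = "\<lambda>x. s 1 x + s 2 x + s 3 x" and ?qm = "\<lambda>x. s 2 x + s 3 x"
  have R: "?R i \<in> carrier_mat M M" if "i \<in> {1..3}" for i
    using received_cov_carrier[OF F G[OF that]] .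
  have R3: "?R 1 \<in> carrier_mat M M" "?R 2 \<in> carrier_mat M M" "?R 3 \<in> carrier_mat M M"
    using R by auto
  have s: "(?R i *\<^sub>v x) \<bullet>c x = complex_of_real (s i x)" "0 \<le> s i x"
    "s i x \<le> frobenius_sq (G i) * sqnorm x" if "i \<in> {1..3}" "x \<in> carrier_vec M" for i x
  proof -
    show "(?R i *\<^sub>v x) \<bullet>c x = complex_of_real (s i x)"
      unfolding s_def by (rule received_cov_form[OF F G[OF that(1)] that(2)])
    show "0 \<le> s i x" by (simp add: s_def sqnorm_nonneg)
    have "mat_adjoint F *\<^sub>v x \<in> carrier_vec (2 * M)"
      using mat_adjoint_carrier[OF F] that by simp
    from sqnorm_adjoint_mult_le[OF G[OF that(1)] this]
    show "s i x \<le> frobenius_sq (G i) * sqnorm x"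
      by (simp add: s_def sqnorm_coisometry_adjoint[OF F isom that(2)])
  qed
  have add_form: "((A + B) *\<^sub>v x) \<bullet>c x = (A *\<^sub>v x) \<bullet>c x + (B *\<^sub>v x) \<bullet>c x"
    if "A \<in> carrier_mat M M" "B \<in> carrier_mat M M" "x \<in> carrier_vec M"
    for A B :: "complex Matrix.mat" and x
    using that by (simp add: add_mult_distrib_mat_vec[of _ M M] add_scalar_prod_distrib[of _ M])
  note T = channel_energy_nonneg[of G]
  have plus: "?R 1 + ?R 2 + ?R 3 \<in> carrier_mat M M"
    "\<And>x. x \<in> carrier_vec M \<Longrightarrow> ((?R 1 + ?R 2 + ?R 3) *\<^sub>v x) \<bullet>c x = complex_of_real (?qp x)"
    "\<And>x. x \<in> carrier_vec M \<Longrightarrow> 0 \<le> ?qp x"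
    "\<And>x. x \<in> carrier_vec M \<Longrightarrow> ?qp x \<le> channel_energy G * sqnorm x"
    using R3 s by (auto simp: add_form channel_energy_def distrib_right intro!: add_mono)
  have minus: "?R 2 + ?R 3 \<in> carrier_mat M M"
    "\<And>x. x \<in> carrier_vec M \<Longrightarrow> ((?R 2 + ?R 3) *\<^sub>v x) \<bullet>c x = complex_of_real (?qm x)"
    "\<And>x. x \<in> carrier_vec M \<Longrightarrow> 0 \<le> ?qm x"
    "\<And>x. x \<in> carrier_vec M \<Longrightarrow> ?qm x \<le> channel_energy G * sqnorm x"
  proof -
    show "?qm x \<le> channel_energy G * sqnorm x" if "x \<in> carrier_vec M" for x
      using plus(4)[OF that] s(2)[of 1 x] that by simp
  qed (use R3 s in \<open>auto simp: add_form\<close>)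
  have m: "0 < real M" using M by simp
  show "\<bar>rate_plus M P F G - rate_minus M P F G\<bar> \<le> M * log 2 (1 + P / M * channel_energy G)" if "P > 0"
  proof -
    have "0 \<le> rate_plus M P F G \<and> rate_plus M P F G \<le> M * log 2 (1 + P / M * channel_energy G)"
      unfolding rate_plus_def by (rule log_det_one_plus_psd(1)[OF plus m that T])
    moreover have "0 \<le> rate_minus M P F G \<and> rate_minus M P F G \<le> M * log 2 (1 + P / M * channel_energy G)"
      unfolding rate_minus_def by (rule log_det_one_plus_psd(1)[OF minus m that T])
    ultimately show ?thesis by linarith
  qed
  show "((\<lambda>P. (rate_plus M P F G - rate_minus M P F G) / log 2 P) \<longlongrightarrow> 0) at_top"
    if pos: "\<And>y. y \<in> carrier_vec (2 * M) \<Longrightarrow> y \<noteq> 0\<^sub>v (2 * M) \<Longrightarrow>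
        0 < sqnorm (mat_adjoint (G 2) *\<^sub>v y) + sqnorm (mat_adjoint (G 3) *\<^sub>v y)"
  proof -
    have qm: "0 < ?qm x" if x: "x \<in> carrier_vec M" "x \<noteq> 0\<^sub>v M" for x
    proof -
      have Fx: "mat_adjoint F *\<^sub>v x \<in> carrier_vec (2 * M)"
        using mat_adjoint_carrier[OF F] x by simp
      \<comment> \<open>The adjoint of a coisometry preserves norms and is therefore
        injective.\<close>
      moreover have "mat_adjoint F *\<^sub>v x \<noteq> 0\<^sub>v (2 * M)"
        using sqnorm_coisometry_adjoint[OF F isom x(1)] x sqnorm_eq_0_iff[OF x(1)] sqnorm_eq_0_iff[OF Fx]
        by simp
      ultimately show ?thesis unfolding s_def by (rule pos)
    qed
    have qp: "0 < ?qp x" if x: "x \<in> carrier_vec M" "x \<noteq> 0\<^sub>v M" for x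
      using qm[OF x] s(2)[of 1 x] x by simp
    have "((\<lambda>P. rate_plus M P F G / log 2 P) \<longlongrightarrow> real M) at_top"
      unfolding rate_plus_def by (rule log_det_one_plus_psd(2)[OF plus m qp])
    moreover have "((\<lambda>P. rate_minus M P F G / log 2 P) \<longlongrightarrow> real M) at_top"
      unfolding rate_minus_def by (rule log_det_one_plus_psd(2)[OF minus m qm])
    ultimately show ?thesis
      using tendsto_diff by (fastforce simp: diff_divide_distrib)
  qed
qed

section \<open>Interference in all receive dimensions\<close>

text \<open>If both terms vanish, \<open>y\<close> is orthogonal to every column of the square
  matrix formed by \<open>G 2\<close> and \<open>G 3\<close> side by side, which is impossible for a
  nonsingular matrix and \<open>y\<close> nonzero.\<close>

lemma interference_positive:
  assumes G2: "G 2 \<in> carrier_mat (2 * M) M" and G3: "G 3 \<in> carrier_mat (2 * M) M"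
    and det: "Determinant.det (Matrix.mat (2 * M) (2 * M)
      (\<lambda>(r, c). if c < M then G 2 $$ (r, c) else G 3 $$ (r, c - M))) \<noteq> 0"
    and y: "y \<in> carrier_vec (2 * M)" "y \<noteq> 0\<^sub>v (2 * M)"
  shows "0 < sqnorm (mat_adjoint (G 2) *\<^sub>v y) + sqnorm (mat_adjoint (G 3) *\<^sub>v y)"
proof (rule ccontr)
  assume "\<not> ?thesis"
  then have "sqnorm (mat_adjoint (G 2) *\<^sub>v y) = 0" "sqnorm (mat_adjoint (G 3) *\<^sub>v y) = 0"
    using sqnorm_nonneg[of "mat_adjoint (G 2) *\<^sub>v y"] sqnorm_nonneg[of "mat_adjoint (G 3) *\<^sub>v y"]
    by linarith+
  then have zero: "mat_adjoint (G 2) *\<^sub>v y = 0\<^sub>v M" "mat_adjoint (G 3) *\<^sub>v y = 0\<^sub>v M"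
    using mat_adjoint_carrier[OF G2] mat_adjoint_carrier[OF G3] y(1)
    by (auto simp: sqnorm_eq_0_iff[of _ M])
  let ?W = "Matrix.mat (2 * M) (2 * M) (\<lambda>(r, c). if c < M then G 2 $$ (r, c) else G 3 $$ (r, c - M))"
  have entry: "(\<Sum>r<2 * M. A $$ (r, c) * cnj (vec_index y r)) = 0"
    if A: "A \<in> carrier_mat (2 * M) M" "mat_adjoint A *\<^sub>v y = 0\<^sub>v M" and c: "c < M"
    for A :: "complex Matrix.mat" and c
  proof -
    have "vec_index (mat_adjoint A *\<^sub>v y) c = (\<Sum>r<2 * M. cnj (A $$ (r, c)) * vec_index y r)"
      using A(1) y c by (simp add: scalar_prod_def atLeast0LessThan mat_adjoint_index)
    then have "cnj (\<Sum>r<2 * M. cnj (A $$ (r, c)) * vec_index y r) = 0"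
      using A c by simp
    then show ?thesis by simp
  qed
  \<comment> \<open>Orthogonality is conjugated so that a kernel vector of the transpose arises,
    whose determinant equals that of \<open>?W\<close>.\<close>
  have "transpose_mat ?W *\<^sub>v conjugate y = 0\<^sub>v (2 * M)"
  proof (rule eq_vecI)
    fix c assume "c < dim_vec (0\<^sub>v (2 * M))"
    then have c: "c < 2 * M" by simp
    have "vec_index (transpose_mat ?W *\<^sub>v conjugate y) c = (\<Sum>r<2 * M. ?W $$ (r, c) * cnj (vec_index y r))"
      using c y(1) by (simp add: scalar_prod_def atLeast0LessThan)
    also have "\<dots> = 0"
      using c entry[OF G2 zero(1), of c] entry[OF G3 zero(2), of "c - M"]
      by (cases "c < M") auto
    finally show "vec_index (transpose_mat ?W *\<^sub>v conjugate y) c = vec_index (0\<^sub>v (2 * M)) c"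
      using c by simp
  qed simp
  moreover have "conjugate y \<in> carrier_vec (2 * M)" "conjugate y \<noteq> 0\<^sub>v (2 * M)"
    using y by (auto simp: conjugate_zero_iff_vec)
  ultimately have "Determinant.det (transpose_mat ?W) = 0"
    by (subst det_0_iff_vec_prod_zero[of _ "2 * M"]) auto
  then show False using det by (simp add: det_transpose[of _ "2 * M"])
qed

section \<open>The postprocessing matrix\<close>

text \<open>Needed to apply \<open>orthonormal_eigenvectors\<close>, which speaks about Hermitian
  matrices.\<close>

lemma interference_cov_hermitian:
  assumes G2: "G 2 \<in> carrier_mat n m" and G3: "G 3 \<in> carrier_mat n m"
  shows "interference_cov G \<in> carrier_mat n n"
    and "mat_adjoint (interference_cov G) = interference_cov G"
proof -
  show "interference_cov G \<in> carrier_mat n n"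
    unfolding interference_cov_def using G2 G3 by (intro add_carrier_mat mult_carrier_mat) auto
  show "mat_adjoint (interference_cov G) = interference_cov G"
    unfolding interference_cov_def using G2 G3
    by (intro eq_matI) (auto simp: mat_adjoint_index scalar_prod_def mult.commute)
qed

text \<open>The shift by \<open>M + 1\<close> reconciles rows counted from 0 with eigenvectors
  counted from 1, of which the last \<open>M\<close> are kept.\<close>

lemma postprocessing_index:
  assumes v: "\<And>n. n \<in> {M + 1..2 * M} \<Longrightarrow> v n B \<in> carrier_vec (2 * M)"
  shows "postprocessing M v B \<in> carrier_mat M (2 * M)"
    and "i < M \<Longrightarrow> j < 2 * M \<Longrightarrow> postprocessing M v B $$ (i, j) = cnj (vec_index (v (M + 1 + i) B) j)"
proof -
  show "postprocessing M v B \<in> carrier_mat M (2 * M)"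
    unfolding postprocessing_def by (intro mat_adjoint_carrier) auto
  show "postprocessing M v B $$ (i, j) = cnj (vec_index (v (M + 1 + i) B) j)" if "i < M" "j < 2 * M"
    unfolding postprocessing_def using that v[of "M + 1 + i"]
    by (simp add: mat_adjoint_index mat_of_cols_index del: upt_Suc)
qed

text \<open>The entries of the product of \<open>F\<close> with its adjoint are the inner products
  of the kept eigenvectors, which are orthonormal.\<close>

lemma postprocessing_coisometry:
  assumes orth: "orthonormal_eigenvectors (2 * M) v"
    and B: "B \<in> carrier_mat (2 * M) (2 * M)" "mat_adjoint B = B"
  shows "postprocessing M v B \<in> carrier_mat M (2 * M)"
    and "postprocessing M v B * mat_adjoint (postprocessing M v B) = 1\<^sub>m M"
    and "i < M \<Longrightarrow> j < 2 * M \<Longrightarrow> postprocessing M v B $$ (i, j) = cnj (vec_index (v (M + 1 + i) B) j)"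
proof -
  let ?F = "postprocessing M v B"
  have v: "v n B \<in> carrier_vec (2 * M)" if "n \<in> {1..2 * M}" for n
    using orth B that unfolding orthonormal_eigenvectors_def eigenvector_def by auto
  have ortho: "v m B \<bullet>c v n B = (if m = n then 1 else 0)" if "m \<in> {1..2 * M}" "n \<in> {1..2 * M}" for m n
    using orth B that unfolding orthonormal_eigenvectors_def by blast
  have v': "\<And>n. n \<in> {M + 1..2 * M} \<Longrightarrow> v n B \<in> carrier_vec (2 * M)" using v by auto
  show F: "?F \<in> carrier_mat M (2 * M)"
    by (rule postprocessing_index(1)) (rule v')
  show idx: "?F $$ (i, j) = cnj (vec_index (v (M + 1 + i) B) j)" if "i < M" "j < 2 * M" for i j
    by (rule postprocessing_index(2)[OF _ that]) (rule v')
  show "?F * mat_adjoint ?F = 1\<^sub>m M"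
  proof (rule eq_matI)
    fix i j assume "i < dim_row (1\<^sub>m M)" "j < dim_col (1\<^sub>m M)"
    then have ij: "i < M" "j < M" by auto
    have "(?F * mat_adjoint ?F) $$ (i, j) = (\<Sum>k<2 * M. ?F $$ (i, k) * cnj (?F $$ (j, k)))"
      using F ij by (simp add: scalar_prod_def atLeast0LessThan mat_adjoint_index)
    \<comment> \<open>The rows of \<open>F\<close> are conjugated eigenvectors, hence
      \<open>j\<close> comes before \<open>i\<close>.\<close>
    also have "\<dots> = v (M + 1 + j) B \<bullet>c v (M + 1 + i) B"
      using ij v[of "M + 1 + i"] v[of "M + 1 + j"]
      by (simp add: idx scalar_prod_def atLeast0LessThan mult.commute)
    finally show "(?F * mat_adjoint ?F) $$ (i, j) = 1\<^sub>m M $$ (i, j)"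
      using ij by (subst (asm) ortho) auto
  qed (use F in auto)
qed

section \<open>Averaging over the channel\<close>

lemma log2_one_plus_le: "0 \<le> x \<Longrightarrow> log 2 (1 + x) \<le> x / ln 2"
  unfolding log_def by (intro divide_right_mono ln_add_one_self_le_self) auto

text \<open>Dominated convergence for a choice among finitely many users that may change with
  \<open>P\<close>. For \<open>P \<ge> 2\<close>, \<open>log 2 (1 + P / m * T)\<close> is at most
  \<open>log 2 P + log 2 (1 + T)\<close>, hence at most \<open>(1 + T / ln 2) * log 2 P\<close>.
  After division by \<open>log 2 P\<close> this bound is free of \<open>P\<close>, and its sum over
  all users is integrable.\<close>

lemma (in prob_space) selected_rate_vanishes:
  fixes g :: "nat \<Rightarrow> real \<Rightarrow> 'a \<Rightarrow> real" and T :: "nat \<Rightarrow> 'a \<Rightarrow> real" and s :: "real \<Rightarrow> 'a \<Rightarrow> nat"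
    and m :: nat
  assumes m: "m \<ge> 1"
    and g: "\<And>k P. k \<in> {1..K} \<Longrightarrow> P > 0 \<Longrightarrow> g k P \<in> borel_measurable M"
    and bound: "\<And>k P \<omega>. k \<in> {1..K} \<Longrightarrow> P > 0 \<Longrightarrow> \<omega> \<in> space M \<Longrightarrow> \<bar>g k P \<omega>\<bar> \<le> m * log 2 (1 + P / m * T k \<omega>)"
    and T: "\<And>k \<omega>. 0 \<le> T k \<omega>" "\<And>k. k \<in> {1..K} \<Longrightarrow> integrable M (T k)"
    and lim: "\<And>k. k \<in> {1..K} \<Longrightarrow> AE \<omega> in M. ((\<lambda>P. g k P \<omega> / log 2 P) \<longlongrightarrow> 0) at_top"
    and s: "\<And>P. P > 0 \<Longrightarrow> s P \<in> M \<rightarrow>\<^sub>M count_space UNIV"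
    and range: "\<And>P \<omega>. P > 0 \<Longrightarrow> \<omega> \<in> space M \<Longrightarrow> s P \<omega> \<in> {1..K}"
  shows "(\<forall>P>0. integrable M (\<lambda>\<omega>. g (s P \<omega>) P \<omega>)) \<and>
    ((\<lambda>P. (\<integral>\<omega>. g (s P \<omega>) P \<omega> \<partial>M) / log 2 P) \<longlongrightarrow> 0) at_top"
proof
  have meas: "(\<lambda>\<omega>. g (s P \<omega>) P \<omega>) \<in> borel_measurable M" if P: "P > 0" for P
  proof (subst measurable_cong)
    show "g (s P \<omega>) P \<omega> = (\<Sum>k\<in>{1..K}. if s P \<omega> = k then g k P \<omega> else 0)" if "\<omega> \<in> space M" for \<omega>
      using range[OF P that] by simp
    show "(\<lambda>\<omega>. \<Sum>k\<in>{1..K}. if s P \<omega> = k then g k P \<omega> else 0) \<in> borel_measurable M"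
    proof (rule borel_measurable_sum)
      fix k assume k: "k \<in> {1..K}"
      note [measurable] = g[OF k P] s[OF P]
      show "(\<lambda>\<omega>. if s P \<omega> = k then g k P \<omega> else 0) \<in> borel_measurable M" by measurable
    qed
  qed
  show "\<forall>P>0. integrable M (\<lambda>\<omega>. g (s P \<omega>) P \<omega>)"
  proof (intro allI impI)
    fix P :: real assume P: "P > 0"
    \<comment> \<open>For a fixed \<open>P\<close> the estimate of \<open>log 2 (1 + x)\<close> by
      \<open>x / ln 2\<close> gives a bound linear in the integrable \<open>T k\<close>.\<close>
    let ?w = "\<lambda>\<omega>. \<Sum>k\<in>{1..K}. m * (P / m * T k \<omega> / ln 2)"
    show "integrable M (\<lambda>\<omega>. g (s P \<omega>) P \<omega>)"
    proof (rule Bochner_Integration.integrable_bound)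
      show "integrable M ?w"
        using T(2) m by (intro Bochner_Integration.integrable_sum) simp
      show "AE \<omega> in M. norm (g (s P \<omega>) P \<omega>) \<le> norm (?w \<omega>)"
      proof (rule AE_I2)
        fix \<omega> assume \<omega>: "\<omega> \<in> space M"
        let ?k = "s P \<omega>"
        have k: "?k \<in> {1..K}" by (rule range[OF P \<omega>])
        have "\<bar>g ?k P \<omega>\<bar> \<le> m * log 2 (1 + P / m * T ?k \<omega>)" by (rule bound[OF k P \<omega>])
        also have "\<dots> \<le> m * (P / m * T ?k \<omega> / ln 2)"
          using T(1) P by (intro mult_left_mono log2_one_plus_le) auto
        also have "\<dots> \<le> ?w \<omega>"
          using T(1) P by (intro member_le_sum[OF k]) auto
        finally show "norm (g ?k P \<omega>) \<le> norm (?w \<omega>)" by simp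
      qed
    qed (rule meas[OF P])
  qed
  \<comment> \<open>The convergence theorem asks for measurability at every real \<open>P\<close>,
    while \<open>g\<close> is controlled for positive \<open>P\<close>. Truncating at 2 also ensures
    \<open>log 2 P \<ge> 1\<close> and leaves the limit at infinity unchanged.\<close>
  define S where "S P \<omega> = (if P \<ge> 2 then g (s P \<omega>) P \<omega> / log 2 P else 0)" for P \<omega>
  let ?w = "\<lambda>\<omega>. \<Sum>k\<in>{1..K}. m * (1 + T k \<omega> / ln 2)"
  have "((\<lambda>P. \<integral>\<omega>. S P \<omega> \<partial>M) \<longlongrightarrow> (\<integral>\<omega>. 0 \<partial>M)) at_top"
  proof (rule integral_dominated_convergence_at_top)
    show "S P \<in> borel_measurable M" for P
      unfolding S_def using meas[of P] by (cases "P \<ge> 2") auto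
    show "integrable M ?w"
      using T(2) by (intro Bochner_Integration.integrable_sum) simp
    show "\<forall>\<^sub>F P in at_top. AE \<omega> in M. norm (S P \<omega>) \<le> ?w \<omega>"
      using eventually_ge_at_top[of 2]
    proof eventually_elim
      case (elim P)
      show ?case
      proof (rule AE_I2)
        fix \<omega> assume \<omega>: "\<omega> \<in> space M"
        let ?k = "s P \<omega>"
        have P: "P > 0" and log1: "1 \<le> log 2 P" using elim by auto
        have k: "?k \<in> {1..K}" by (rule range[OF P \<omega>])
        have "\<bar>g ?k P \<omega>\<bar> \<le> m * log 2 (1 + P / m * T ?k \<omega>)" by (rule bound[OF k P \<omega>])
        also have "\<dots> \<le> m * log 2 (P * (1 + T ?k \<omega>))"
        proof (intro mult_left_mono)
          \<comment> \<open>Here \<open>m \<ge> 1\<close> removes the division; below,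
            \<open>P \<ge> 1\<close> absorbs the summand 1 into \<open>P\<close>.\<close>
          have "P / m * T ?k \<omega> \<le> P * T ?k \<omega>"
            using m P T(1)[of ?k \<omega>] by (intro mult_right_mono) (auto simp: field_simps)
          then have "1 + P / m * T ?k \<omega> \<le> P * (1 + T ?k \<omega>)"
            using elim by (simp add: distrib_left)
          moreover have "0 \<le> P / m * T ?k \<omega>" using P T(1)[of ?k \<omega>] by simp
          ultimately show "log 2 (1 + P / m * T ?k \<omega>) \<le> log 2 (P * (1 + T ?k \<omega>))"
            by (subst log_le_cancel_iff) linarith+
        qed simp
        also have "\<dots> \<le> m * (log 2 P + T ?k \<omega> / ln 2)"
          using P T(1)[of ?k \<omega>] log2_one_plus_le[of "T ?k \<omega>"]
          by (intro mult_left_mono) (auto simp: log_mult)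
        also have "\<dots> \<le> m * (1 + T ?k \<omega> / ln 2) * log 2 P"
        proof -
          have "T ?k \<omega> / ln 2 * 1 \<le> T ?k \<omega> / ln 2 * log 2 P"
            using log1 T(1)[of ?k \<omega>] by (intro mult_left_mono) auto
          then show ?thesis
            unfolding mult.assoc by (intro mult_left_mono) (auto simp: distrib_right)
        qed
        finally have "\<bar>g ?k P \<omega>\<bar> / log 2 P \<le> m * (1 + T ?k \<omega> / ln 2)"
          using log1 by (simp add: pos_divide_le_eq)
        also have "\<dots> \<le> ?w \<omega>"
          using T(1) by (intro member_le_sum[OF k]) auto
        finally show "norm (S P \<omega>) \<le> ?w \<omega>"
          using elim log1 by (simp add: S_def abs_divide)
      qed
    qed
    have "AE \<omega> in M. \<forall>k\<in>{1..K}. ((\<lambda>P. g k P \<omega> / log 2 P) \<longlongrightarrow> 0) at_top"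
      using lim by (intro AE_finite_allI) auto
    then show "AE \<omega> in M. ((\<lambda>P. S P \<omega>) \<longlongrightarrow> 0) at_top"
      using AE_space
    proof eventually_elim
      case (elim \<omega>)
      \<comment> \<open>The selected user may keep changing as \<open>P\<close> grows, so a limit
        for each fixed user does not apply directly; the sum over all users dominates and still
        tends to 0.\<close>
      have "((\<lambda>P. \<Sum>k\<in>{1..K}. \<bar>g k P \<omega> / log 2 P\<bar>) \<longlongrightarrow> (\<Sum>k\<in>{1..K}. 0)) at_top"
        using elim(1) by (intro tendsto_sum tendsto_rabs_zero) (rule bspec)
      then have "((\<lambda>P. \<Sum>k\<in>{1..K}. \<bar>g k P \<omega> / log 2 P\<bar>) \<longlongrightarrow> 0) at_top"
        unfolding sum.neutral_const .
      moreover have "\<forall>\<^sub>F P in at_top. norm (S P \<omega>) \<le> (\<Sum>k\<in>{1..K}. \<bar>g k P \<omega> / log 2 P\<bar>)"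
        using eventually_ge_at_top[of 2]
      proof eventually_elim
        fix P :: real assume P: "2 \<le> P"
        have "\<bar>g (s P \<omega>) P \<omega> / log 2 P\<bar> \<le> (\<Sum>k\<in>{1..K}. \<bar>g k P \<omega> / log 2 P\<bar>)"
          using range[of P \<omega>] P elim
          by (intro member_le_sum[where f = "\<lambda>k. \<bar>g k P \<omega> / log 2 P\<bar>"]) auto
        then show "norm (S P \<omega>) \<le> (\<Sum>k\<in>{1..K}. \<bar>g k P \<omega> / log 2 P\<bar>)" using P by (simp add: S_def)
      qed
      ultimately show ?case by (rule Lim_null_comparison[rotated])
    qed
  qed (rule borel_measurable_const)
  then have "((\<lambda>P. \<integral>\<omega>. S P \<omega> \<partial>M) \<longlongrightarrow> 0) at_top" by simp
  moreover have "\<forall>\<^sub>F P in at_top. (\<integral>\<omega>. S P \<omega> \<partial>M) = (\<integral>\<omega>. g (s P \<omega>) P \<omega> \<partial>M) / log 2 P"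
    using eventually_ge_at_top[of 2] by eventually_elim (simp add: S_def)
  ultimately show "((\<lambda>P. (\<integral>\<omega>. g (s P \<omega>) P \<omega> \<partial>M) / log 2 P) \<longlongrightarrow> 0) at_top"
    by (rule Lim_transform_eventually)
qed

section \<open>Application to the interference channel\<close>

context interference_channel
begin

lemma channel_measurable:
  assumes "k \<in> {1..K}" "i \<in> {1..3}"
  shows "measurable_mat \<Omega> (2 * M) M (\<lambda>\<omega>. H \<omega> k i)"
  unfolding measurable_mat_def
  using dims assms entries_gaussian by (auto intro: std_complex_gaussian_measurable)

lemma channel_energy_integrable:
  assumes k: "k \<in> {1..K}"
  shows "integrable \<Omega> (\<lambda>\<omega>. channel_energy (H \<omega> k))"
proof -
  have "integrable \<Omega> (\<lambda>\<omega>. frobenius_sq (H \<omega> k i))" if i: "i \<in> {1..3}" for i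
  proof (subst Bochner_Integration.integrable_cong[OF refl])
    show "frobenius_sq (H \<omega> k i) = (\<Sum>r<2 * M. \<Sum>c<M. (cmod (H \<omega> k i $$ (r, c)))\<^sup>2)"
      if "\<omega> \<in> space \<Omega>" for \<omega>
      using dims[OF that k i] by (simp add: frobenius_sq_def)
    show "integrable \<Omega> (\<lambda>\<omega>. \<Sum>r<2 * M. \<Sum>c<M. (cmod (H \<omega> k i $$ (r, c)))\<^sup>2)"
      by (intro Bochner_Integration.integrable_sum std_complex_gaussian_square_integrable
          entries_gaussian[OF k i]) auto
  qed
  then show ?thesis
    unfolding channel_energy_def by (intro Bochner_Integration.integrable_add) auto
qed

text \<open>Two blocks of \<open>M\<close> columns form a square matrix whose entries are distinct
  members of the independent Gaussian family, so the atomless determinant criterion applies.\<close>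

lemma interference_nonsingular:
  assumes k: "k \<in> {1..K}"
  shows "AE \<omega> in \<Omega>. Determinant.det (Matrix.mat (2 * M) (2 * M)
    (\<lambda>(r, c). if c < M then H \<omega> k 2 $$ (r, c) else H \<omega> k 3 $$ (r, c - M))) \<noteq> 0"
proof -
  define X where "X = (\<lambda>(k, i, r, c) \<omega>. H \<omega> k i $$ (r, c))"
  \<comment> \<open>Positions in the first \<open>M\<close> columns go to channel 2 and the others
    to channel 3; disjoint labels make the map injective.\<close>
  define \<phi> where "\<phi> = (\<lambda>(r, c). if c < M then (k, 2 :: nat, r :: nat, c) else (k, 3, r, c - M))"
  let ?J = "{1..K} \<times> {1..3} \<times> {..<2 * M} \<times> {..<M}"
  have "AE \<omega> in \<Omega>. Determinant.det (Matrix.mat (2 * M) (2 * M) (\<lambda>p. X (\<phi> p) \<omega>)) \<noteq> 0"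
  proof (rule AE_det_nonzero[where J = ?J])
    show "indep_vars (\<lambda>_. borel) X ?J" unfolding X_def by (rule entries_indep)
    show "AE \<omega> in \<Omega>. X a \<omega> \<noteq> z" if "a \<in> ?J" for a z
      using that unfolding X_def
      by (auto intro!: std_complex_gaussian_atomless entries_gaussian)
    show "inj_on \<phi> ({..<2 * M} \<times> {..<2 * M})"
      by (auto simp: \<phi>_def inj_on_def split: if_splits)
    show "\<phi> ` ({..<2 * M} \<times> {..<2 * M}) \<subseteq> ?J"
      using k by (auto simp: \<phi>_def split: if_splits)
  qed
  moreover have "(\<lambda>p. X (\<phi> p) \<omega>) = (\<lambda>(r, c). if c < M then H \<omega> k 2 $$ (r, c) else H \<omega> k 3 $$ (r, c - M))"
    for \<omega>
    by (auto simp: X_def \<phi>_def)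
  ultimately show ?thesis by simp
qed

text \<open>The selection rule \<open>s\<close> is left general and may depend on \<open>P\<close>,
  so that both schemes are instances. Measurability of the eigenvector entries makes each user's
  rate a random variable.\<close>

lemma selected_user_rate_vanishes:
  assumes M: "M \<ge> 1"
    and eigenvectors: "orthonormal_eigenvectors (2 * M) v"
    and eigenvectors_measurable:
      "\<And>k n j. \<lbrakk>k \<in> {1..K}; n \<in> {M + 1..2 * M}; j < 2 * M\<rbrakk> \<Longrightarrow>
        (\<lambda>\<omega>. vec_index (v n (interference_cov (H \<omega> k))) j) \<in> borel_measurable \<Omega>"
    and s: "\<And>P. P > 0 \<Longrightarrow> s P \<in> \<Omega> \<rightarrow>\<^sub>M count_space UNIV"
    and range: "\<And>P \<omega>. P > 0 \<Longrightarrow> \<omega> \<in> space \<Omega> \<Longrightarrow> s P \<omega> \<in> {1..K}"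
  shows "(\<forall>P>0. integrable \<Omega> (\<lambda>\<omega>. user_rate M v P (H \<omega> (s P \<omega>)))) \<and>
    ((\<lambda>P. average_rate \<Omega> M H v (s P) P / log 2 P) \<longlongrightarrow> 0) at_top"
proof -
  let ?F = "\<lambda>k \<omega>. postprocessing M v (interference_cov (H \<omega> k))"
  have F: "?F k \<omega> \<in> carrier_mat M (2 * M)" "?F k \<omega> * mat_adjoint (?F k \<omega>) = 1\<^sub>m M"
    "i < M \<Longrightarrow> j < 2 * M \<Longrightarrow> ?F k \<omega> $$ (i, j) = cnj (vec_index (v (M + 1 + i) (interference_cov (H \<omega> k))) j)"
    if "k \<in> {1..K}" "\<omega> \<in> space \<Omega>" for k \<omega> i j
  proof -
    have "H \<omega> k 2 \<in> carrier_mat (2 * M) M" "H \<omega> k 3 \<in> carrier_mat (2 * M) M"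
      using dims[OF that(2,1)] by auto
    note postprocessing_coisometry[OF eigenvectors interference_cov_hermitian[OF this]]
    then show "?F k \<omega> \<in> carrier_mat M (2 * M)" "?F k \<omega> * mat_adjoint (?F k \<omega>) = 1\<^sub>m M"
      "i < M \<Longrightarrow> j < 2 * M \<Longrightarrow> ?F k \<omega> $$ (i, j) = cnj (vec_index (v (M + 1 + i) (interference_cov (H \<omega> k))) j)"
      by blast+
  qed
  have F_meas: "measurable_mat \<Omega> M (2 * M) (?F k)" if k: "k \<in> {1..K}" for k
  proof (rule measurable_matI[where B = "\<lambda>i j \<omega>. cnj (vec_index (v (M + 1 + i) (interference_cov (H \<omega> k))) j)"])
    fix i j assume "i < M" "j < 2 * M"
    then show "(\<lambda>\<omega>. cnj (vec_index (v (M + 1 + i) (interference_cov (H \<omega> k))) j)) \<in> borel_measurable \<Omega>"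
      by (intro borel_measurable_cnj eigenvectors_measurable[OF k]) auto
  qed (use F[OF k] in auto)
  have cov_meas: "measurable_mat \<Omega> M M (\<lambda>\<omega>. received_cov (?F k \<omega>) (H \<omega> k i))"
    if k: "k \<in> {1..K}" and i: "i \<in> {1..3}" for k i
    unfolding received_cov_def
    by (rule measurable_mat_mult[OF measurable_mat_mult[OF measurable_mat_mult[OF F_meas[OF k] channel_measurable[OF k i]]
          measurable_mat_adjoint[OF channel_measurable[OF k i]]] measurable_mat_adjoint[OF F_meas[OF k]]])
  have rate_meas: "(\<lambda>\<omega>. user_rate M v P (H \<omega> k)) \<in> borel_measurable \<Omega>" if k: "k \<in> {1..K}" for k P
  proof -
    have *: "(\<lambda>\<omega>. log 2 (Re (Determinant.det (1\<^sub>m M + complex_of_real (P / real M) \<cdot>\<^sub>m A \<omega>))))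
      \<in> borel_measurable \<Omega>" if "measurable_mat \<Omega> M M A" for A
      by (rule borel_measurable_log, rule measurable_compose[OF borel_measurable_det borel_measurable_Re])
        (rule measurable_mat_add[OF measurable_mat_one measurable_mat_smult[OF that]], simp)
    note C = cov_meas[OF k]
    show ?thesis
      unfolding user_rate_def Let_def rate_plus_def rate_minus_def
      by (intro borel_measurable_diff *[OF measurable_mat_add[OF measurable_mat_add[OF C C] C]]
          *[OF measurable_mat_add[OF C C]]) simp_all
  qed
  have G: "\<And>i. i \<in> {1..3} \<Longrightarrow> H \<omega> k i \<in> carrier_mat (2 * M) M" if "k \<in> {1..K}" "\<omega> \<in> space \<Omega>" for k \<omega>
    using dims[OF that(2,1)] .
  show ?thesis
    unfolding average_rate_def
  proof (rule selected_rate_vanishes[where m = M and T = "\<lambda>k \<omega>. channel_energy (H \<omega> k)" and K = K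
        and g = "\<lambda>k P \<omega>. user_rate M v P (H \<omega> k)"])
    show "\<bar>user_rate M v P (H \<omega> k)\<bar> \<le> M * log 2 (1 + P / M * channel_energy (H \<omega> k))"
      if "k \<in> {1..K}" "P > 0" "\<omega> \<in> space \<Omega>" for k P \<omega>
      unfolding user_rate_def Let_def
      using that by (intro rate_bounds(1) M G F)
    show "AE \<omega> in \<Omega>. ((\<lambda>P. user_rate M v P (H \<omega> k) / log 2 P) \<longlongrightarrow> 0) at_top"
      if k: "k \<in> {1..K}" for k
      using interference_nonsingular[OF k] AE_space
    proof eventually_elim
      case (elim \<omega>)
      show ?case
        unfolding user_rate_def Let_def
      proof (rule rate_bounds(2)[OF M G[OF k elim(2)] F(1,2)[OF k elim(2)]])
        show "0 < sqnorm (mat_adjoint (H \<omega> k 2) *\<^sub>v y) + sqnorm (mat_adjoint (H \<omega> k 3) *\<^sub>v y)"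
          if "y \<in> carrier_vec (2 * M)" "y \<noteq> 0\<^sub>v (2 * M)" for y
          using G[OF k elim(2)] by (intro interference_positive[OF _ _ elim(1) that]) auto
      qed
    qed
  qed (rule M rate_meas channel_energy_nonneg channel_energy_integrable s range; assumption)+
qed

end

theorem lemma5:
  fixes \<Omega> :: "'a measure" and M K :: nat
    and H Ht :: "'a \<Rightarrow> nat \<Rightarrow> nat \<Rightarrow> complex Matrix.mat"
    and v :: "nat \<Rightarrow> complex Matrix.mat \<Rightarrow> complex Matrix.vec"
    and k1 :: "real \<Rightarrow> 'a \<Rightarrow> nat" and k2 :: "'a \<Rightarrow> nat"
  assumes "M \<ge> 1" and "K \<ge> 1"
    and channel: "interference_channel \<Omega> M K H"
    and eigenvectors: "orthonormal_eigenvectors (2 * M) v"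
    and eigenvectors_measurable:
      "\<And>k n j. \<lbrakk>k \<in> {1..K}; n \<in> {M + 1..2 * M}; j < 2 * M\<rbrakk> \<Longrightarrow>
        (\<lambda>\<omega>. vec_index (v n (interference_cov (H \<omega> k))) j) \<in> borel_measurable \<Omega>"
    and k1_measurable: "\<And>P. P > 0 \<Longrightarrow> k1 P \<in> measurable \<Omega> (count_space UNIV)"
    and k1_argmin: "\<And>P \<omega>. \<lbrakk>P > 0; \<omega> \<in> space \<Omega>\<rbrakk> \<Longrightarrow>
        is_arg_min (\<lambda>k. oia1_metric M P (H \<omega> k)) (\<lambda>k. k \<in> {1..K}) (k1 P \<omega>)"
    and bases: "AE \<omega> in \<Omega>. \<forall>k \<in> {1..K}. \<forall>i \<in> {2, 3}.
        orthonormal_basis_mat M (H \<omega> k i) (Ht \<omega> k i)"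
    and k2_measurable: "k2 \<in> measurable \<Omega> (count_space UNIV)"
    and k2_range: "\<And>\<omega>. \<omega> \<in> space \<Omega> \<Longrightarrow> k2 \<omega> \<in> {1..K}"
    and k2_argmin: "AE \<omega> in \<Omega>.
        is_arg_min (\<lambda>k. chordal_dist_sq M (Ht \<omega> k 2) (Ht \<omega> k 3)) (\<lambda>k. k \<in> {1..K}) (k2 \<omega>)"
  shows
    "(\<forall>P > 0. integrable \<Omega> (\<lambda>\<omega>. user_rate M v P (H \<omega> (k1 P \<omega>)))) \<and>
     ((\<lambda>P. average_rate \<Omega> M H v (k1 P) P / log 2 P) \<longlongrightarrow> 0) at_top \<and>
     (\<forall>P > 0. integrable \<Omega> (\<lambda>\<omega>. user_rate M v P (H \<omega> (k2 \<omega>)))) \<and>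
     ((\<lambda>P. average_rate \<Omega> M H v k2 P / log 2 P) \<longlongrightarrow> 0) at_top"
proof -
  interpret interference_channel \<Omega> M K H by (rule channel)
  have k1_range: "k1 P \<omega> \<in> {1..K}" if "P > 0" "\<omega> \<in> space \<Omega>" for P \<omega>
    using k1_argmin[OF that] by (simp add: is_arg_min_def)
  note vanishes = selected_user_rate_vanishes[OF \<open>M \<ge> 1\<close> eigenvectors eigenvectors_measurable]
  show ?thesis
    \<comment> \<open>The rule of OIA1 varies with \<open>P\<close>; that of OIA2 enters as a
      constant family.\<close>
    using vanishes[of k1] vanishes[of "\<lambda>_. k2"] k1_measurable k1_range k2_measurable k2_range
    by blast
qed

end
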